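(* (Universal work extraction.) Let $\mathcal{X}=\{1,\dots,m\}$, let $\mathcal{Y}$ be a finite set of cardinality $k$, let $k_BT>0$, and let $P_X$ be a probability mass function on $\mathcal{X}$ with $P_X(x)>0$ for all $x$. Consider the universal control protocol which in cycle $i$, having observed $y^i=(y_1,\dots,y_i)$ and $x^{i-1}=(x_1,\dots,x_{i-1})$, uses the distribution $$Q_{X_i|y^i,x^{i-1}}=\left(\frac{n_i(1,y_i)+1}{n_i(y_i)+m},\dots,\frac{n_i(m,y_i)+1}{n_i(y_i)+m}\right),$$ where $n_i(j,y)=|\{l<i: x_l=j,\ y_l=y\}|$ and $n_i(y)=|\{l<i: y_l=y\}|$. Let $$\hat W_n=k_BT\sum_{i=1}^n\ln\frac{Q_{X_i|y^i,x^{i-1}}(x_i)}{P_X(x_i)}$$ be the work it extracts over $n$ cycles, and let $$W_n^*=\max_{\{Q_{X|y}\}_{y\in\mathcal{Y}}}k_BT\sum_{i=1}^n\ln\frac{Q_{X|y_i}(x_i)}{P_X(x_i)}$$ be the work extracted by the best constant control protocol, the maximum being over all families of probability distributions $Q_{X|y}$ on $\mathcal{X}$ indexed by $y\in\mathcal{Y}$. Then for every $n\ge1$ and all sequences $x^n\in\mathcal{X}^n$, $y^n\in\mathcal{Y}^n$, $$\hat W_n\ge W_n^*-k_BT\,k(m-1)\ln(n+1).$$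
   Context: In the underlying engine, $x_i$ is the state (particle location) in cycle $i$, $y_i$ the measurement result in cycle $i$, $P_X$ the equilibrium distribution of the state at the start of each cycle, and a control protocol amounts to choosing a probability distribution $Q$ on $\mathcal{X}$; the work extracted in a cycle with state $x$ is $k_BT\ln(Q(x)/P_X(x))$. A constant protocol is one whose distribution in cycle $i$ depends only on $y_i$ through a time-invariant rule. $k_B$ is the Boltzmann constant and $T$ the temperature; $k$ (without subscript) is the cardinality of $\mathcal{Y}$. *)

theory Defs
  imports "HOL-Probability.Probability"
begin

text \<open>
  The state space is the set \<open>{1..m}\<close> of naturals, and distributions on it are
  elements of \<^typ>\<open>nat pmf\<close> whose support is contained in \<open>{1..m}\<close>. Sequences are
  functions on \<^typ>\<open>nat\<close> of which only the entries with indices \<open>1, \<dots>, n\<close> matter.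
\<close>

text \<open>
  A constant protocol may give probability \<open>0\<close> to a state that occurs. The work is then
  \<open>-\<infinity>\<close>, whereas \<open>ln 0 = 0\<close> in HOL; hence the extended logarithm (only used for
  nonnegative arguments).
\<close>

definition eln :: "real \<Rightarrow> ereal" where
  "eln z = (if z = 0 then -\<infinity> else ereal (ln z))"

text \<open>\<open>Q i\<close> is the distribution on states that the protocol uses in cycle \<open>i\<close>.\<close>

definition extracted_work ::
  "real \<Rightarrow> nat pmf \<Rightarrow> (nat \<Rightarrow> nat pmf) \<Rightarrow> (nat \<Rightarrow> nat) \<Rightarrow> nat \<Rightarrow> ereal" where
  "extracted_work kBT P Q x n =
     ereal kBT * (\<Sum>i\<in>{1..n}. eln (pmf (Q i) (x i) / pmf P (x i)))"

definition count_joint ::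
  "(nat \<Rightarrow> nat) \<Rightarrow> (nat \<Rightarrow> 'y) \<Rightarrow> nat \<Rightarrow> nat \<Rightarrow> 'y \<Rightarrow> nat" where
  "count_joint x y i j c = card {l \<in> {1..<i}. x l = j \<and> y l = c}"

definition count_meas :: "(nat \<Rightarrow> 'y) \<Rightarrow> nat \<Rightarrow> 'y \<Rightarrow> nat" where
  "count_meas y i c = card {l \<in> {1..<i}. y l = c}"

definition universal_prob ::
  "nat \<Rightarrow> (nat \<Rightarrow> nat) \<Rightarrow> (nat \<Rightarrow> 'y) \<Rightarrow> nat \<Rightarrow> nat \<Rightarrow> real" where
  "universal_prob m x y i j =
     (if j \<in> {1..m}
      then (real (count_joint x y i j (y i)) + 1) / (real (count_meas y i (y i)) + real m)
      else 0)"

definition universal_protocol ::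
  "nat \<Rightarrow> (nat \<Rightarrow> nat) \<Rightarrow> (nat \<Rightarrow> 'y) \<Rightarrow> nat \<Rightarrow> nat pmf" where
  "universal_protocol m x y i = embed_pmf (universal_prob m x y i)"

text \<open>
  The next lemma shows that \<^const>\<open>embed_pmf\<close> is applied to a genuine probability mass
  function as soon as the past states lie in \<open>{1..m}\<close>.
\<close>

lemma pmf_universal_protocol:
  assumes "m \<ge> 1" and x: "\<And>l. l \<in> {1..<i} \<Longrightarrow> x l \<in> {1..m}"
  shows "pmf (universal_protocol m x y i) j = universal_prob m x y i j"
  unfolding universal_protocol_def
proof (rule pmf_embed_pmf)
  show nonneg: "0 \<le> universal_prob m x y i j" for j
    by (simp add: universal_prob_def)
  have "{l \<in> {1..<i}. y l = y i} = (\<Union>j\<in>{1..m}. {l \<in> {1..<i}. x l = j \<and> y l = y i})"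
    using x by auto
  then have "count_meas y i (y i) = card (\<Union>j\<in>{1..m}. {l \<in> {1..<i}. x l = j \<and> y l = y i})"
    by (simp add: count_meas_def)
  also have "\<dots> = (\<Sum>j\<in>{1..m}. count_joint x y i j (y i))"
    unfolding count_joint_def by (rule card_UN_disjoint) auto
  finally have "(\<Sum>j\<in>{1..m}. real (count_joint x y i j (y i)) + 1)
      = real (count_meas y i (y i)) + real m"
    by (simp add: sum.distrib)
  then have sum1: "(\<Sum>j\<in>{1..m}. universal_prob m x y i j) = 1"
    using \<open>m \<ge> 1\<close> by (simp add: universal_prob_def flip: sum_divide_distrib)
  have "(\<integral>\<^sup>+j. ennreal (universal_prob m x y i j) \<partial>count_space UNIV)
      = (\<Sum>j\<in>{1..m}. ennreal (universal_prob m x y i j))"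
    by (rule nn_integral_count_space') (auto simp: universal_prob_def)
  also have "\<dots> = ennreal (\<Sum>j\<in>{1..m}. universal_prob m x y i j)"
    by (rule sum_ennreal) (rule nonneg)
  finally show "(\<integral>\<^sup>+j. ennreal (universal_prob m x y i j) \<partial>count_space UNIV) = 1"
    using sum1 by simp
qed

definition universal_work ::
  "real \<Rightarrow> nat \<Rightarrow> nat pmf \<Rightarrow> (nat \<Rightarrow> nat) \<Rightarrow> (nat \<Rightarrow> 'y) \<Rightarrow> nat \<Rightarrow> ereal" where
  "universal_work kBT m P x y n = extracted_work kBT P (universal_protocol m x y) x n"

definition constant_protocols :: "nat \<Rightarrow> 'y set \<Rightarrow> ('y \<Rightarrow> nat pmf) set" where
  "constant_protocols m Y = {Q. \<forall>c\<in>Y. set_pmf (Q c) \<subseteq> {1..m}}"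

definition constant_work ::
  "real \<Rightarrow> nat pmf \<Rightarrow> ('y \<Rightarrow> nat pmf) \<Rightarrow> (nat \<Rightarrow> nat) \<Rightarrow> (nat \<Rightarrow> 'y) \<Rightarrow> nat \<Rightarrow> ereal" where
  "constant_work kBT P Q x y n = extracted_work kBT P (\<lambda>i. Q (y i)) x n"

definition best_constant_work ::
  "real \<Rightarrow> nat \<Rightarrow> 'y set \<Rightarrow> nat pmf \<Rightarrow> (nat \<Rightarrow> nat) \<Rightarrow> (nat \<Rightarrow> 'y) \<Rightarrow> nat \<Rightarrow> ereal" where
  "best_constant_work kBT m Y P x y n =
     (SUP Q\<in>constant_protocols m Y. constant_work kBT P Q x y n)"

end

theory Submission
  imports Defs
begin

text \<open>
  The cycles are split according to the measurement result. On the class \<open>A\<close> of one result, with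
  \<open>N = card A\<close> cycles of which \<open>N j\<close> are in state \<open>j\<close>, the probabilities used by the universal
  protocol multiply to \<open>(m - 1)! (\<Prod>j. (N j)!) / (N + m - 1)!\<close>. A constant distribution \<open>p\<close> gives
  \<open>\<Prod>j. p j ^ N j\<close>, and this is at most \<open>(\<Prod>j. (N j)!) / N!\<close> because
  \<open>N! / (\<Prod>j. (N j)!) * (\<Prod>j. p j ^ N j)\<close> is a single term of the multinomial expansion
  of \<open>(\<Sum>j. p j) ^ N = 1\<close>. So each class loses at most the factor
  \<open>(N + m - 1)! / (N! (m - 1)!) \<le> (N + 1) ^ (m - 1)\<close>. The best constant protocol uses
  the empirical distribution of each class, by Gibbs' inequality.
\<close>

section \<open>Rising factorials, multinomial terms and factorial bounds\<close>

text \<open>The ranks of the elements of \<open>A\<close> are 0, ..., \<open>card A - 1\<close>. The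
  induction adds a new largest element, which gets rank \<open>card A\<close> and leaves the other
  ranks unchanged.\<close>

lemma prod_add_card_less:
  fixes z :: "'a :: comm_semiring_1" and A :: "'b :: linorder set"
  assumes "finite A"
  shows "(\<Prod>i\<in>A. z + of_nat (card {l \<in> A. l < i})) = pochhammer z (card A)"
  using assms
proof (induction A rule: finite_linorder_max_induct)
  case empty
  then show ?case by simp
next
  case (insert b A)
  have "{l \<in> insert b A. l < i} = {l \<in> A. l < i}" if "i \<in> A" for i
    using insert that by force
  moreover have "{l \<in> insert b A. l < b} = A"
    using insert by auto
  moreover have "b \<notin> A"
    using insert by auto
  ultimately show ?case
    using insert by (simp add: pochhammer_Suc mult.commute)
qed

text \<open>The sum of \<open>p\<close> is left general, because the induction splits off one point
  and the remaining values no longer have total 1. Splitting off \<open>a\<close> costs one term of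
  the binomial expansion of \<open>(t + s) ^ (N a + M)\<close>.\<close>

lemma multinomial_term_le:
  fixes p :: "'a \<Rightarrow> real" and N :: "'a \<Rightarrow> nat"
  assumes "finite S" and "\<And>j. j \<in> S \<Longrightarrow> p j \<ge> 0"
  shows "(\<Prod>j\<in>S. p j ^ N j) * fact (\<Sum>j\<in>S. N j)
           \<le> (\<Prod>j\<in>S. fact (N j)) * (\<Sum>j\<in>S. p j) ^ (\<Sum>j\<in>S. N j)"
  using assms
proof (induction S rule: finite_induct)
  case empty
  then show ?case by simp
next
  case (insert a S)
  define s t M where "s = (\<Sum>j\<in>S. p j)" and "t = p a" and "M = (\<Sum>j\<in>S. N j)"
  have nonneg: "s \<ge> 0" "t \<ge> 0"
    using insert by (auto simp: s_def t_def intro: sum_nonneg)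
  have "real (N a + M choose N a) * t ^ N a * s ^ M \<le> (t + s) ^ (N a + M)"
  proof -
    have "real (N a + M choose N a) * t ^ N a * s ^ (N a + M - N a)
        \<le> (\<Sum>i\<le>N a + M. real (N a + M choose i) * t ^ i * s ^ (N a + M - i))"
      by (rule member_le_sum) (use nonneg in auto)
    then show ?thesis
      by (simp add: binomial_ring)
  qed
  then have "fact (N a) * fact M * (real (N a + M choose N a) * t ^ N a * s ^ M)
      \<le> fact (N a) * fact M * (t + s) ^ (N a + M)"
    by (intro mult_left_mono) auto
  moreover have "fact (N a) * fact M * real (N a + M choose N a) = fact (N a + M)"
    using binomial_fact_lemma[of "N a" "N a + M"]
    by (metis add_diff_cancel_left' le_add1 of_nat_fact of_nat_mult)
  ultimately have two: "fact (N a + M) * t ^ N a * s ^ M \<le> fact (N a) * fact M * (t + s) ^ (N a + M)"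
    by (metis mult.assoc)
  define F where "F = (\<Prod>j\<in>S. fact (N j) :: real)"
  have F: "F > 0"
    by (auto simp: F_def intro: prod_pos)
  have IH: "(\<Prod>j\<in>S. p j ^ N j) * fact M \<le> F * s ^ M"
    using insert by (simp add: s_def M_def F_def)
  \<comment> \<open>The extra factor \<open>fact M\<close> lets the induction hypothesis and the
    binomial estimate be chained; it is cancelled at the end.\<close>
  have "(t ^ N a * (\<Prod>j\<in>S. p j ^ N j) * fact (N a + M)) * fact M
      = (t ^ N a * fact (N a + M)) * ((\<Prod>j\<in>S. p j ^ N j) * fact M)"
    by (simp add: mult_ac)
  also have "\<dots> \<le> (t ^ N a * fact (N a + M)) * (F * s ^ M)"
    using IH nonneg by (intro mult_left_mono) auto
  also have "\<dots> = F * (fact (N a + M) * t ^ N a * s ^ M)"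
    by (simp add: mult_ac)
  also have "\<dots> \<le> F * (fact (N a) * fact M * (t + s) ^ (N a + M))"
    using two F by (intro mult_left_mono) auto
  also have "\<dots> = (fact (N a) * F * (t + s) ^ (N a + M)) * fact M"
    by (simp add: mult_ac)
  finally have "t ^ N a * (\<Prod>j\<in>S. p j ^ N j) * fact (N a + M)
      \<le> fact (N a) * F * (t + s) ^ (N a + M)"
    by (simp add: mult_le_cancel_right)
  then show ?case
    using insert by (simp add: s_def t_def M_def F_def)
qed

text \<open>Each step uses N + M + 1 \<le> (N + 1)(M + 1). Equivalently, the binomial coefficient of
  N + M over M is a product of M factors (N + i)/i, each at most N + 1.\<close>

lemma fact_add_le:
  "(fact (N + M) :: real) \<le> fact N * fact M * (real N + 1) ^ M"
proof (induction M)
  case 0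
  then show ?case by simp
next
  case (Suc M)
  have "(fact (N + Suc M) :: real) = (real N + real M + 1) * fact (N + M)"
    by (simp add: algebra_simps)
  also have "\<dots> \<le> ((real N + 1) * (real M + 1)) * (fact N * fact M * (real N + 1) ^ M)"
    by (rule mult_mono) (use Suc in \<open>auto simp: algebra_simps\<close>)
  also have "\<dots> = fact N * fact (Suc M) * (real N + 1) ^ Suc M"
    by (simp add: algebra_simps)
  finally show ?case .
qed

text \<open>With M = m - 1 the left side is the product of the universal protocol's denominators
  over a class of N cycles; it equals (N + M)!/M!.\<close>

lemma pochhammer_le_fact_mult_power:
  "pochhammer (real M + 1) N \<le> fact N * (real N + 1) ^ M"
proof -
  have "fact M * pochhammer (real M + 1) N = fact (N + M)"
    using pochhammer_product'[of "1::real" M N] by (simp add: pochhammer_fact add.commute)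
  also have "\<dots> \<le> fact M * (fact N * (real N + 1) ^ M)"
    using fact_add_le[of N M] by (simp add: mult_ac)
  finally show ?thesis
    by simp
qed

section \<open>Comparisons within the cycles of one measurement result\<close>

lemma prod_eq_prod_power_card:
  fixes p :: "'a \<Rightarrow> 'b :: comm_semiring_1"
  assumes "finite A" "finite S" "x ` A \<subseteq> S"
  shows "(\<Prod>i\<in>A. p (x i)) = (\<Prod>j\<in>S. p j ^ card {i \<in> A. x i = j})"
proof -
  have "(\<Prod>i\<in>A. p (x i)) = (\<Prod>j\<in>S. \<Prod>i\<in>{i \<in> A. x i = j}. p (x i))"
    by (rule prod.group[symmetric]) (use assms in auto)
  also have "\<dots> = (\<Prod>j\<in>S. p j ^ card {i \<in> A. x i = j})"
    by (rule prod.cong) auto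
  finally show ?thesis .
qed

lemma sum_card_fibres:
  assumes "finite A" "finite S" "x ` A \<subseteq> S"
  shows "(\<Sum>j\<in>S. card {i \<in> A. x i = j}) = card A"
proof -
  have "(\<Sum>j\<in>S. \<Sum>i\<in>{i \<in> A. x i = j}. 1::nat) = (\<Sum>i\<in>A. 1)"
    by (rule sum.group) (use assms in auto)
  then show ?thesis
    by simp
qed

text \<open>\<open>M\<close> stands for m - 1 and is independent of \<open>S\<close>, so
  \<open>S\<close> may consist of the occurring states only; this is why \<open>p\<close> is only
  required to have sum at most 1 on \<open>S\<close>.\<close>

lemma prod_le_prod_add_one_rule:
  fixes p :: "'a \<Rightarrow> real" and A :: "'b :: linorder set"
  assumes "finite A" "finite S" "x ` A \<subseteq> S"
    and nonneg: "\<And>j. j \<in> S \<Longrightarrow> p j \<ge> 0" and sum_le: "(\<Sum>j\<in>S. p j) \<le> 1"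
  shows "(\<Prod>i\<in>A. p (x i)) \<le> (real (card A) + 1) ^ M *
           (\<Prod>i\<in>A. (real (card {l \<in> A. l < i \<and> x l = x i}) + 1)
                     / (real (card {l \<in> A. l < i}) + real M + 1))"
proof -
  define N where "N j = card {i \<in> A. x i = j}" for j
  have num: "(\<Prod>i\<in>A. real (card {l \<in> A. l < i \<and> x l = x i}) + 1) = (\<Prod>j\<in>S. fact (N j))"
  proof -
    have "(\<Prod>i\<in>A. real (card {l \<in> A. l < i \<and> x l = x i}) + 1)
        = (\<Prod>j\<in>S. \<Prod>i\<in>{i \<in> A. x i = j}. real (card {l \<in> A. l < i \<and> x l = x i}) + 1)"
      by (rule prod.group[symmetric]) (use assms in auto)
    \<comment> \<open>On the fibre of \<open>j\<close> the numerator is one plus the rank within the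
      fibre, so the fibre contributes \<open>pochhammer 1 (N j)\<close>, a factorial.\<close>
    also have "\<dots> = (\<Prod>j\<in>S. \<Prod>i\<in>{i \<in> A. x i = j}. 1 + real (card {l \<in> {i \<in> A. x i = j}. l < i}))"
      by (intro prod.cong refl) (auto intro!: arg_cong[where f = card])
    also have "\<dots> = (\<Prod>j\<in>S. fact (N j))"
    proof (rule prod.cong[OF refl])
      fix j
      have "finite {i \<in> A. x i = j}"
        using \<open>finite A\<close> by simp
      from prod_add_card_less[OF this, of "1::real"]
      show "(\<Prod>i\<in>{i \<in> A. x i = j}. 1 + real (card {l \<in> {i \<in> A. x i = j}. l < i})) = fact (N j)"
        by (simp only: N_def pochhammer_fact)
    qed
    finally show ?thesis .
  qed
  have den: "(\<Prod>i\<in>A. real (card {l \<in> A. l < i}) + real M + 1) = pochhammer (real M + 1) (card A)"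
    using prod_add_card_less[OF \<open>finite A\<close>, of "real M + 1"] by (simp add: ac_simps)
  have pos: "pochhammer (real M + 1) (card A) > 0"
    by (rule pochhammer_pos) simp
  have sumN: "(\<Sum>j\<in>S. N j) = card A"
    unfolding N_def by (rule sum_card_fibres) fact+
  have "(\<Prod>i\<in>A. p (x i)) = (\<Prod>j\<in>S. p j ^ N j)"
    unfolding N_def by (rule prod_eq_prod_power_card) fact+
  then have "(\<Prod>i\<in>A. p (x i)) * fact (card A) \<le> (\<Prod>j\<in>S. fact (N j)) * (\<Sum>j\<in>S. p j) ^ card A"
    using multinomial_term_le[of S p N] assms by (simp add: sumN)
  also have "\<dots> \<le> (\<Prod>j\<in>S. fact (N j)) * 1"
    using nonneg sum_le by (intro mult_left_mono power_le_one prod_nonneg) (auto intro: sum_nonneg)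
  finally have le: "(\<Prod>i\<in>A. p (x i)) * fact (card A) \<le> (\<Prod>j\<in>S. fact (N j))"
    by simp
  have "(\<Prod>i\<in>A. p (x i)) * pochhammer (real M + 1) (card A)
      \<le> (\<Prod>i\<in>A. p (x i)) * (fact (card A) * (real (card A) + 1) ^ M)"
    using assms by (intro mult_left_mono pochhammer_le_fact_mult_power prod_nonneg) auto
  also have "\<dots> = ((\<Prod>i\<in>A. p (x i)) * fact (card A)) * (real (card A) + 1) ^ M"
    by (simp add: mult_ac)
  also have "\<dots> \<le> (\<Prod>j\<in>S. fact (N j)) * (real (card A) + 1) ^ M"
    by (rule mult_right_mono[OF le]) simp
  finally show ?thesis
    using pos by (simp only: prod_dividef num den) (simp add: field_simps)
qed

text \<open>Gibbs' inequality in product form: each ratio z of \<open>p\<close> to the empirical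
  frequency satisfies z \<le> exp (z - 1), and these ratios sum to at most \<open>card A\<close>
  over the class.\<close>

lemma prod_le_prod_empirical:
  fixes p :: "'a \<Rightarrow> real"
  assumes "finite A" "finite S" "x ` A \<subseteq> S"
    and nonneg: "\<And>j. j \<in> S \<Longrightarrow> p j \<ge> 0" and sum_le: "(\<Sum>j\<in>S. p j) \<le> 1"
  shows "(\<Prod>i\<in>A. p (x i)) \<le> (\<Prod>i\<in>A. real (card {l \<in> A. x l = x i}) / real (card A))"
proof -
  define N where "N j = card {i \<in> A. x i = j}" for j
  define e where "e i = real (N (x i)) / real (card A)" for i
  have e_pos: "e i > 0" if "i \<in> A" for i
    using that \<open>finite A\<close> by (auto simp: e_def N_def card_gt_0_iff intro!: divide_pos_pos)
  have "(\<Sum>i\<in>A. p (x i) / e i) = (\<Sum>j\<in>S. \<Sum>i\<in>{i \<in> A. x i = j}. p (x i) / e i)"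
    by (rule sum.group[symmetric]) (use assms in auto)
  also have "\<dots> = (\<Sum>j\<in>S. real (N j) * (p j * real (card A) / real (N j)))"
    by (rule sum.cong) (auto simp: e_def N_def)
  \<comment> \<open>Terms with \<open>N j > 0\<close> agree; for \<open>N j = 0\<close> the left
    term is 0.\<close>
  also have "\<dots> \<le> (\<Sum>j\<in>S. p j * real (card A))"
    by (rule sum_mono) (use nonneg in auto)
  also have "\<dots> = (\<Sum>j\<in>S. p j) * real (card A)"
    by (simp add: sum_distrib_right)
  also have "\<dots> \<le> 1 * real (card A)"
    by (rule mult_right_mono[OF sum_le]) simp
  finally have "(\<Sum>i\<in>A. p (x i) / e i - 1) \<le> 0"
    by (simp add: sum_subtractf)
  have "(\<Prod>i\<in>A. p (x i) / e i) \<le> (\<Prod>i\<in>A. exp (p (x i) / e i - 1))"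
  proof (rule prod_mono)
    fix i assume i: "i \<in> A"
    show "0 \<le> p (x i) / e i \<and> p (x i) / e i \<le> exp (p (x i) / e i - 1)"
      using e_pos[OF i] nonneg[of "x i"] i assms(3) exp_ge_add_one_self[of "p (x i) / e i - 1"]
      by auto
  qed
  also have "\<dots> = exp (\<Sum>i\<in>A. p (x i) / e i - 1)"
    by (simp add: exp_sum \<open>finite A\<close>)
  also have "\<dots> \<le> 1"
    using \<open>(\<Sum>i\<in>A. p (x i) / e i - 1) \<le> 0\<close> by simp
  finally have "(\<Prod>i\<in>A. p (x i)) \<le> (\<Prod>i\<in>A. e i)"
    using prod_pos[of A e] e_pos by (simp add: prod_dividef divide_le_eq_1)
  then show ?thesis
    by (simp add: e_def N_def)
qed

section \<open>From extended work to products of real probabilities\<close>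

lemma eln_mono: "0 \<le> a \<Longrightarrow> a \<le> b \<Longrightarrow> eln a \<le> eln b"
  by (auto simp: eln_def)

text \<open>This holds at zeros too: a vanishing factor makes the product 0, and its summand
  -\<infinity> dominates since no summand is +\<infinity>.\<close>

lemma sum_eln:
  assumes "finite A" "\<And>i. i \<in> A \<Longrightarrow> f i \<ge> 0"
  shows "(\<Sum>i\<in>A. eln (f i)) = eln (\<Prod>i\<in>A. f i)"
  using assms
proof (induction A rule: finite_induct)
  case (insert a A)
  moreover have "(\<Prod>i\<in>A. f i) \<ge> 0"
    using insert by (auto intro: prod_nonneg)
  ultimately show ?case
    by (auto simp: eln_def ln_mult)
qed (simp add: eln_def)

lemma extracted_work_eq:
  "extracted_work kBT P Q x n =
     ereal kBT * eln ((\<Prod>i\<in>{1..n}. pmf (Q i) (x i)) / (\<Prod>i\<in>{1..n}. pmf P (x i)))"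
  by (simp add: extracted_work_def sum_eln prod_dividef)

lemma sum_pmf_le_1: "finite S \<Longrightarrow> (\<Sum>j\<in>S. pmf p j) \<le> 1"
  by (simp flip: measure_measure_pmf_finite)

section \<open>The best constant protocol\<close>

text \<open>Pushing the uniform distribution on a class forward along \<open>x\<close> gives the
  empirical frequencies. A result that never occurs has an empty class; \<open>x 1\<close> then
  serves as a state that is admissible when \<open>n \<ge> 1\<close>.\<close>

definition empirical_protocol ::
  "(nat \<Rightarrow> nat) \<Rightarrow> (nat \<Rightarrow> 'y) \<Rightarrow> nat \<Rightarrow> 'y \<Rightarrow> nat pmf" where
  "empirical_protocol x y n c =
     (if c \<in> y ` {1..n} then map_pmf x (pmf_of_set {i \<in> {1..n}. y i = c})
      else return_pmf (x 1))"

lemma pmf_empirical_protocol: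
  fixes y :: "nat \<Rightarrow> 'y"
  assumes "i \<in> {1..n}"
  defines "A \<equiv> {l \<in> {1..n}. y l = y i}"
  shows "pmf (empirical_protocol x y n (y i)) j = real (card {l \<in> A. x l = j}) / real (card A)"
proof -
  have "A \<noteq> {}" "finite A"
    using assms by (auto simp: A_def)
  moreover have "A \<inter> x -` {j} = {l \<in> A. x l = j}"
    by auto
  ultimately show ?thesis
    using assms(1) by (simp add: empirical_protocol_def pmf_map measure_pmf_of_set A_def)
qed

lemma empirical_protocol_in_constant_protocols:
  assumes "n \<ge> 1" and "\<And>i. i \<in> {1..n} \<Longrightarrow> x i \<in> {1..m}"
  shows "empirical_protocol x y n \<in> constant_protocols m Y"
proof -
  have "set_pmf (empirical_protocol x y n c) \<subseteq> {1..m}" for c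
  proof (cases "c \<in> y ` {1..n}")
    case True
    then have "{i \<in> {1..n}. y i = c} \<noteq> {}"
      by auto
    then have "set_pmf (empirical_protocol x y n c) = x ` {i \<in> {1..n}. y i = c}"
      using True by (simp add: empirical_protocol_def)
    then show ?thesis
      using assms(2) by auto
  next
    case False
    then show ?thesis
      using assms by (auto simp: empirical_protocol_def)
  qed
  then show ?thesis
    by (simp add: constant_protocols_def)
qed

lemma constant_prod_le_empirical_prod:
  "(\<Prod>i\<in>{1..n}. pmf (Q (y i)) (x i)) \<le> (\<Prod>i\<in>{1..n}. pmf (empirical_protocol x y n (y i)) (x i))"
proof -
  define A where "A c = {i \<in> {1..n}. y i = c}" for c
  have group: "(\<Prod>i\<in>{1..n}. f i) = (\<Prod>c\<in>y ` {1..n}. \<Prod>i\<in>A c. f i)" for f :: "nat \<Rightarrow> real"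
    unfolding A_def by (rule prod.group[symmetric]) auto
  have "(\<Prod>i\<in>A c. pmf (Q (y i)) (x i)) \<le> (\<Prod>i\<in>A c. pmf (empirical_protocol x y n (y i)) (x i))" for c
  proof -
    have "(\<Prod>i\<in>A c. pmf (Q (y i)) (x i)) = (\<Prod>i\<in>A c. pmf (Q c) (x i))"
      by (simp add: A_def)
    also have "\<dots> \<le> (\<Prod>i\<in>A c. real (card {l \<in> A c. x l = x i}) / real (card (A c)))"
      by (rule prod_le_prod_empirical[where S = "x ` A c"]) (auto simp: A_def sum_pmf_le_1)
    also have "\<dots> = (\<Prod>i\<in>A c. pmf (empirical_protocol x y n (y i)) (x i))"
    proof (rule prod.cong[OF refl])
      fix i assume "i \<in> A c"
      then show "real (card {l \<in> A c. x l = x i}) / real (card (A c))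
          = pmf (empirical_protocol x y n (y i)) (x i)"
        by (subst pmf_empirical_protocol) (auto simp: A_def)
    qed
    finally show ?thesis .
  qed
  then show ?thesis
    unfolding group by (intro prod_mono) (auto intro: prod_nonneg)
qed

section \<open>The universal protocol against constant protocols\<close>

text \<open>Each result in \<open>Y\<close> costs one factor \<open>(real n + 1) ^ (m - 1)\<close>,
  since its class has at most \<open>n\<close> cycles; a result that does not occur is charged the
  same factor.\<close>

lemma constant_prod_le_universal_prod:
  assumes "m \<ge> 1" "finite Y"
    and x: "\<And>i. i \<in> {1..n} \<Longrightarrow> x i \<in> {1..m}" and y: "\<And>i. i \<in> {1..n} \<Longrightarrow> y i \<in> Y"
  shows "(\<Prod>i\<in>{1..n}. pmf (Q (y i)) (x i))
      \<le> (real n + 1) ^ ((m - 1) * card Y) * (\<Prod>i\<in>{1..n}. universal_prob m x y i (x i))"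
proof -
  define A where "A c = {i \<in> {1..n}. y i = c}" for c
  define u where "u i = universal_prob m x y i (x i)" for i
  have fin: "finite (A c)" for c
    by (simp add: A_def)
  have u_nonneg: "u i \<ge> 0" for i
    by (simp add: u_def universal_prob_def)
  have group: "(\<Prod>i\<in>{1..n}. f i) = (\<Prod>c\<in>Y. \<Prod>i\<in>A c. f i)" for f :: "nat \<Rightarrow> real"
    unfolding A_def by (rule prod.group[symmetric]) (use y \<open>finite Y\<close> in auto)
  have class_le: "(\<Prod>i\<in>A c. pmf (Q (y i)) (x i)) \<le> (real n + 1) ^ (m - 1) * (\<Prod>i\<in>A c. u i)" for c
  proof -
    \<comment> \<open>The past cycles counted by the protocol in cycle \<open>i\<close> are the
      earlier members of the class of \<open>i\<close>, so each class evolves independently of the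
      others.\<close>
    have u: "u i = (real (card {l \<in> A c. l < i \<and> x l = x i}) + 1)
                     / (real (card {l \<in> A c. l < i}) + real (m - 1) + 1)" if "i \<in> A c" for i
    proof -
      have "{l \<in> {1..<i}. x l = x i \<and> y l = y i} = {l \<in> A c. l < i \<and> x l = x i}"
        and "{l \<in> {1..<i}. y l = y i} = {l \<in> A c. l < i}"
        using that by (auto simp: A_def)
      then show ?thesis
        using that x \<open>m \<ge> 1\<close>
        by (auto simp: u_def universal_prob_def count_joint_def count_meas_def A_def of_nat_diff)
    qed
    have card: "card (A c) \<le> n"
    proof -
      have "card (A c) \<le> card {1..n}"
        by (rule card_mono) (auto simp: A_def)
      then show ?thesis
        by simp
    qed
    have "(\<Prod>i\<in>A c. pmf (Q (y i)) (x i)) = (\<Prod>i\<in>A c. pmf (Q c) (x i))"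
      by (simp add: A_def)
    also have "\<dots> \<le> (real (card (A c)) + 1) ^ (m - 1) * (\<Prod>i\<in>A c. u i)"
      using prod_le_prod_add_one_rule[of "A c" "x ` A c" x "pmf (Q c)" "m - 1"] fin
      by (simp add: u sum_pmf_le_1 cong: prod.cong)
    also have "\<dots> \<le> (real n + 1) ^ (m - 1) * (\<Prod>i\<in>A c. u i)"
      using card u_nonneg by (intro mult_right_mono power_mono prod_nonneg) auto
    finally show ?thesis .
  qed
  have "(\<Prod>i\<in>{1..n}. pmf (Q (y i)) (x i)) \<le> (\<Prod>c\<in>Y. (real n + 1) ^ (m - 1) * (\<Prod>i\<in>A c. u i))"
    unfolding group using class_le by (intro prod_mono) (auto intro: prod_nonneg)
  also have "\<dots> = (real n + 1) ^ ((m - 1) * card Y) * (\<Prod>i\<in>{1..n}. u i)"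
    unfolding group by (simp add: prod.distrib power_mult)
  finally show ?thesis
    by (simp add: u_def)
qed

theorem mainTheorem4:
  fixes kBT :: real and m k n :: nat
    and P :: "nat pmf" and Y :: "'y set"
    and x :: "nat \<Rightarrow> nat" and y :: "nat \<Rightarrow> 'y"
  assumes "kBT > 0"
    and "set_pmf P = {1..m}"
    and "finite Y" and "card Y = k"
    and "n \<ge> 1"
    and "\<And>i. i \<in> {1..n} \<Longrightarrow> x i \<in> {1..m}"
    and "\<And>i. i \<in> {1..n} \<Longrightarrow> y i \<in> Y"
  shows "(\<exists>Q\<in>constant_protocols m Y.
            best_constant_work kBT m Y P x y n = constant_work kBT P Q x y n) \<and>
         universal_work kBT m P x y n \<ge>
           best_constant_work kBT m Y P x y n
             - ereal (kBT * real k * (real m - 1) * ln (real n + 1))"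
proof -
  have "m \<ge> 1"
    using set_pmf_not_empty[of P] assms(2) by (cases m) auto
  let ?E = "empirical_protocol x y n"
  define B where "B = (\<Prod>i\<in>{1..n}. pmf P (x i))"
  define W where "W = (\<Prod>i\<in>{1..n}. pmf (?E (y i)) (x i))"
  define U where "U = (\<Prod>i\<in>{1..n}. universal_prob m x y i (x i))"
  have "B > 0"
    unfolding B_def using assms(2,6) by (intro prod_pos) (auto simp: pmf_positive_iff)
  \<comment> \<open>Cycle \<open>i\<close> itself is counted in the frequency of \<open>x i\<close>.
    Hence the optimal work is finite, and \<open>eln\<close> can be replaced by \<open>ln\<close>
    below.\<close>
  have "pmf (?E (y i)) (x i) > 0" if "i \<in> {1..n}" for i
    using that by (subst pmf_empirical_protocol) (auto simp: card_gt_0_iff intro!: divide_pos_pos)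
  then have "W > 0"
    unfolding W_def by (intro prod_pos) auto
  have "U > 0"
    unfolding U_def using assms(6) \<open>m \<ge> 1\<close>
    by (intro prod_pos) (auto simp: universal_prob_def intro!: divide_pos_pos add_nonneg_pos)
  have E: "?E \<in> constant_protocols m Y"
    using assms by (intro empirical_protocol_in_constant_protocols) auto
  have "constant_work kBT P Q x y n \<le> constant_work kBT P ?E x y n" for Q
    unfolding constant_work_def extracted_work_eq
    using \<open>kBT > 0\<close> \<open>B > 0\<close>
    by (intro ereal_mult_left_mono eln_mono divide_right_mono constant_prod_le_empirical_prod)
       (auto simp: B_def intro!: divide_nonneg_nonneg prod_nonneg)
  then have best: "best_constant_work kBT m Y P x y n = constant_work kBT P ?E x y n"
    unfolding best_constant_work_def using E by (intro antisym SUP_least SUP_upper)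
  have work_E: "constant_work kBT P ?E x y n = ereal (kBT * ln (W / B))"
    using \<open>W > 0\<close> \<open>B > 0\<close> 
    by (simp only: constant_work_def extracted_work_eq flip: B_def W_def) (simp add: eln_def)
  have "(\<Prod>i\<in>{1..n}. pmf (universal_protocol m x y i) (x i)) = U"
    unfolding U_def using assms(6) \<open>m \<ge> 1\<close>
    by (intro prod.cong refl pmf_universal_protocol) auto
  then have work_U: "universal_work kBT m P x y n = ereal (kBT * ln (U / B))"
    using \<open>U > 0\<close> \<open>B > 0\<close>
    by (simp only: universal_work_def extracted_work_eq flip: B_def) (simp add: eln_def)
  have "W \<le> (real n + 1) ^ ((m - 1) * k) * U"
    using constant_prod_le_universal_prod[of m Y n x y ?E] assms \<open>m \<ge> 1\<close> by (simp add: W_def U_def)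
  then have "ln W \<le> ln ((real n + 1) ^ ((m - 1) * k) * U)"
    using \<open>W > 0\<close> by simp
  \<comment> \<open>\<open>m \<ge> 1\<close> turns the truncated difference in the exponent into
    \<open>real m - 1\<close>.\<close>
  also have "\<dots> = real k * (real m - 1) * ln (real n + 1) + ln U"
    using \<open>U > 0\<close> \<open>m \<ge> 1\<close> by (simp add: ln_mult ln_realpow of_nat_diff mult_ac)
  finally have "kBT * ln (W / B) \<le> kBT * (real k * (real m - 1) * ln (real n + 1) + ln (U / B))"
    using \<open>kBT > 0\<close> \<open>W > 0\<close> \<open>U > 0\<close> \<open>B > 0\<close> by (intro mult_left_mono) (auto simp: ln_div)
  then have "kBT * ln (W / B) - kBT * real k * (real m - 1) * ln (real n + 1) \<le> kBT * ln (U / B)"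
    by (simp add: algebra_simps)
  then have "universal_work kBT m P x y n \<ge> best_constant_work kBT m Y P x y n
      - ereal (kBT * real k * (real m - 1) * ln (real n + 1))"
    by (simp add: best work_E work_U)
  then show ?thesis
    using E best by blast
qed

end
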